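(* Let $\{J_B\}$ be real numbers indexed by the finite subsets $B\subset\mathbb{Z}^d$ with $|B|\ge2$, such that $\sup_{i\in\mathbb{Z}^d}\sum_{B:i\in B}|J_B|<\infty$, and let $\beta>0$. Let $i\in\mathbb{Z}^d$. Then: 1. The sequence $(\lambda_i(k))_{k\ge0}$ is a probability distribution on $\{0,1,2,\dots\}$. 2. For every integer $\ell\ge1$ and every $\sigma\in S=\{-1,1\}^{\mathbb{Z}^d}$, $$c_i^{[\ell]}(\sigma)=M_i\Big[\tfrac12\lambda_i(0)+\sum_{k=1}^{\ell}\lambda_i(k)\,p_i^{[k]}(-\sigma(i)\mid\sigma)\Big].$$ 3. For every $\sigma\in S$, $$c_i(\sigma)=M_i\Big[\tfrac12\lambda_i(0)+\sum_{k=1}^{\infty}\lambda_i(k)\,p_i^{[k]}(-\sigma(i)\mid\sigma)\Big].$$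
   Context: Notation: $\|i\|=\sum_{k=1}^d|i_k|$ on $\mathbb{Z}^d$, $B_i(k)=\{j\in\mathbb{Z}^d:\|j-i\|\le k\}$, $\chi_B(\sigma)=\prod_{j\in B}\sigma(j)$. All sums over $B$ run over finite subsets of $\mathbb{Z}^d$ with at least two elements. Rates: $c_i(\sigma)=\exp\big(-\beta\sum_{B:i\in B}J_B\chi_B(\sigma)\big)$, and for $\ell\ge1$, $c_i^{[\ell]}(\sigma)=r_i^{[\ell]}\exp\big(-\beta\sum_{B:i\in B,\,B\subset B_i(\ell)}J_B\chi_B(\sigma)\big)$ with $r_i^{[\ell]}=e^{-\beta\sum_{B:i\in B,\,B\not\subset B_i(\ell)}|J_B|}$. Constants: $M_i=2e^{\beta\sum_{B:i\in B}|J_B|}$; $\lambda_i(0)=e^{-2\beta\sum_{B:i\in B}|J_B|}$; $\lambda_i(1)=e^{-\beta\sum_{B:i\in B,\,B\not\subset B_i(1)}|J_B|}-e^{-2\beta\sum_{B:i\in B}|J_B|}$; for $k>1$, $\lambda_i(k)=e^{-\beta\sum_{B:i\in B,\,B\not\subset B_i(k)}|J_B|}-e^{-\beta\sum_{B:i\in B,\,B\not\subset B_i(k-1)}|J_B|}$. Update probabilities: for $k\ge2$, writing $\mathcal{D}_i(k)=\{B: i\in B,\ B\subset B_i(k),\ B\not\subset B_i(k-1)\}$, $$p_i^{[k]}(-\sigma(i)\mid\sigma)=\frac1{M_i}e^{-\beta\sum_{B:i\in B,\,B\subset B_i(k-1)}J_B\chi_B(\sigma)}\ \frac{e^{-\beta\sum_{B\in\mathcal{D}_i(k)}J_B\chi_B(\sigma)}-e^{-\beta\sum_{B\in\mathcal{D}_i(k)}|J_B|}}{1-e^{-\beta\sum_{B\in\mathcal{D}_i(k)}|J_B|}},$$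 and for $k=1$, $$p_i^{[1]}(-\sigma(i)\mid\sigma)=\frac1{M_i}\ \frac{e^{-\beta\sum_{B:i\in B,\,B\subset B_i(1)}J_B\chi_B(\sigma)}-e^{-\beta\sum_{B:i\in B,\,B\subset B_i(1)}|J_B|}}{1-e^{-2\beta\sum_{B:i\in B,\,B\subset B_i(1)}|J_B|}\,e^{-\beta\sum_{B:i\in B,\,B\not\subset B_i(1)}|J_B|}}.$$ If a denominator above vanishes (in which case $\lambda_i(k)=0$), $p_i^{[k]}(-\sigma(i)\mid\sigma)$ is given an arbitrary value in $[0,1]$. *)

theory Defs
  imports "HOL-Analysis.Analysis"
begin

type_synonym 'd site = "int ^ 'd"
type_synonym 'd config = "'d site \<Rightarrow> real"

definition configs :: "'d config set" where
  "configs = UNIV \<rightarrow> {- 1, 1}"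

definition l1norm :: "'d::finite site \<Rightarrow> int" where
  "l1norm x = (\<Sum>k\<in>UNIV. \<bar>x $ k\<bar>)"

definition box_at :: "'d::finite site \<Rightarrow> nat \<Rightarrow> 'd site set" where
  "box_at i k = {j. l1norm (j - i) \<le> int k}"

definition chi :: "'d site set \<Rightarrow> 'd config \<Rightarrow> real" where
  "chi B \<sigma> = (\<Prod>j\<in>B. \<sigma> j)"

definition bonds :: "'d site \<Rightarrow> 'd site set set" where
  "bonds i = {B. finite B \<and> 2 \<le> card B \<and> i \<in> B}"

definition bonds_in :: "'d::finite site \<Rightarrow> nat \<Rightarrow> 'd site set set" where
  "bonds_in i k = {B \<in> bonds i. B \<subseteq> box_at i k}"

definition bonds_out :: "'d::finite site \<Rightarrow> nat \<Rightarrow> 'd site set set" where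
  "bonds_out i k = {B \<in> bonds i. \<not> B \<subseteq> box_at i k}"

text \<open>The set \<open>\<D>\<^sub>i(k)\<close>; only used for \<open>k \<ge> 2\<close>.\<close>

definition shell :: "'d::finite site \<Rightarrow> nat \<Rightarrow> 'd site set set" where
  "shell i k = {B \<in> bonds i. B \<subseteq> box_at i k \<and> \<not> B \<subseteq> box_at i (k - 1)}"

text \<open>The value of \<open>\<Sum>\<^sub>\<infinity>\<close> is only meaningful for summable families. Under the
  standing assumption \<open>summable_interaction\<close> below, all the families occurring here
  are absolutely summable.\<close>

definition signed_sum ::
    "('d site set \<Rightarrow> real) \<Rightarrow> 'd site set set \<Rightarrow> 'd config \<Rightarrow> real" where
  "signed_sum J \<A> \<sigma> = (\<Sum>\<^sub>\<infinity>B\<in>\<A>. J B * chi B \<sigma>)"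

definition abs_sum :: "('d site set \<Rightarrow> real) \<Rightarrow> 'd site set set \<Rightarrow> real" where
  "abs_sum J \<A> = (\<Sum>\<^sub>\<infinity>B\<in>\<A>. \<bar>J B\<bar>)"

text \<open>Taken in \<^typ>\<open>ennreal\<close>, where divergent sums have value \<open>\<infinity>\<close> rather than
  the default value \<open>0\<close>.\<close>

definition summable_interaction :: "('d::finite site set \<Rightarrow> real) \<Rightarrow> bool" where
  "summable_interaction J \<longleftrightarrow> (SUP i. \<Sum>\<^sub>\<infinity>B\<in>bonds i. ennreal \<bar>J B\<bar>) < \<infinity>"

definition rate ::
    "('d site set \<Rightarrow> real) \<Rightarrow> real \<Rightarrow> 'd::finite site \<Rightarrow> 'd config \<Rightarrow> real" where
  "rate J \<beta> i \<sigma> = exp (- \<beta> * signed_sum J (bonds i) \<sigma>)"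

definition range_factor ::
    "('d site set \<Rightarrow> real) \<Rightarrow> real \<Rightarrow> 'd::finite site \<Rightarrow> nat \<Rightarrow> real" where
  "range_factor J \<beta> i l = exp (- \<beta> * abs_sum J (bonds_out i l))"

definition rate_range ::
    "('d site set \<Rightarrow> real) \<Rightarrow> real \<Rightarrow> 'd::finite site \<Rightarrow> nat \<Rightarrow> 'd config \<Rightarrow> real" where
  "rate_range J \<beta> i l \<sigma> =
     range_factor J \<beta> i l * exp (- \<beta> * signed_sum J (bonds_in i l) \<sigma>)"

definition M_const :: "('d site set \<Rightarrow> real) \<Rightarrow> real \<Rightarrow> 'd::finite site \<Rightarrow> real" where
  "M_const J \<beta> i = 2 * exp (\<beta> * abs_sum J (bonds i))"

definition range_prob ::
    "('d site set \<Rightarrow> real) \<Rightarrow> real \<Rightarrow> 'd::finite site \<Rightarrow> nat \<Rightarrow> real" where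
  "range_prob J \<beta> i k =
     (if k = 0 then exp (- 2 * \<beta> * abs_sum J (bonds i))
      else if k = 1 then
        exp (- \<beta> * abs_sum J (bonds_out i 1)) - exp (- 2 * \<beta> * abs_sum J (bonds i))
      else
        exp (- \<beta> * abs_sum J (bonds_out i k)) - exp (- \<beta> * abs_sum J (bonds_out i (k - 1))))"

definition flip_denom ::
    "('d site set \<Rightarrow> real) \<Rightarrow> real \<Rightarrow> 'd::finite site \<Rightarrow> nat \<Rightarrow> real" where
  "flip_denom J \<beta> i k =
     (if k = 1 then
        1 - exp (- 2 * \<beta> * abs_sum J (bonds_in i 1)) * exp (- \<beta> * abs_sum J (bonds_out i 1))
      else 1 - exp (- \<beta> * abs_sum J (shell i k)))"

text \<open>\<open>flip_prob J \<beta> i a k \<sigma>\<close> is \<open>p\<^sub>i\<^sup>[\<^sup>k\<^sup>](-\<sigma>(i) | \<sigma>)\<close> for \<open>k \<ge> 1\<close> (the value at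
  \<open>k = 0\<close> is irrelevant). The argument \<open>a\<close> supplies the arbitrary values
  taken when the denominator vanishes.\<close>

definition flip_prob ::
    "('d site set \<Rightarrow> real) \<Rightarrow> real \<Rightarrow> 'd::finite site \<Rightarrow> (nat \<Rightarrow> 'd config \<Rightarrow> real) \<Rightarrow>
      nat \<Rightarrow> 'd config \<Rightarrow> real" where
  "flip_prob J \<beta> i a k \<sigma> =
     (if flip_denom J \<beta> i k = 0 then a k \<sigma>
      else if k = 1 then
        1 / M_const J \<beta> i *
        ((exp (- \<beta> * signed_sum J (bonds_in i 1) \<sigma>) - exp (- \<beta> * abs_sum J (bonds_in i 1)))
          / flip_denom J \<beta> i 1)
      else
        1 / M_const J \<beta> i * exp (- \<beta> * signed_sum J (bonds_in i (k - 1)) \<sigma>) *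
        ((exp (- \<beta> * signed_sum J (shell i k) \<sigma>) - exp (- \<beta> * abs_sum J (shell i k)))
          / flip_denom J \<beta> i k))"

end

theory Submission
  imports Defs
begin

text \<open>
  Everything rests on a telescoping. Let \<open>A\<close>, \<open>In k\<close>, \<open>Out k\<close> and \<open>Sh k\<close> be the sums of
  \<open>\<bar>J B\<bar>\<close> over all bonds at \<open>i\<close>, over those inside the ball of radius \<open>k\<close>, over those not inside
  it, and over the shell. Since \<open>A = In 1 + Out 1\<close> and \<open>Out (k - 1) = Out k + Sh k\<close>, the
  probability of radius \<open>k \<ge> 1\<close> factorises as \<open>exp (- \<beta> * Out k)\<close> times the denominator in
  the definition of the flip probability (\<open>range_prob_one_factor\<close>, \<open>range_prob_Suc_factor\<close>).
  Multiplying by the flip probability cancels this denominator, and splitting the signed sum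
  over the ball of radius \<open>k\<close> into the ball of radius \<open>k - 1\<close> and the shell leaves the difference of
  two consecutive truncated rates (\<open>rate_range_Suc_increment\<close>). The recursion starts with
  \<open>exp (- \<beta> * A)\<close>, which is half of \<open>M\<close> times the probability of radius \<open>0\<close>.
  When the denominator vanishes, so does the relevant absolute sum, hence the signed sum as
  well: the probability of radius \<open>k\<close> and the difference of the rates are then both zero, so the
  recursion holds for every value of the flip probability.

  The finite-range identity is thus a finite telescoping sum. The probabilities themselves
  telescope too, with partial sums \<open>exp (- \<beta> * Out n)\<close> for \<open>n \<ge> 1\<close>. Both infinite statements then follow from
  \<open>Out n \<longlonglongrightarrow> 0\<close> (\<open>abs_sum_bonds_out_tendsto_0\<close>): each bond is finite and so lies in a
  large enough ball, and the signed sum over the bonds leaving that ball is dominated by \<open>Out n\<close>.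
\<close>

section \<open>Absolutely summable interactions\<close>

text \<open>Every infinite sum in \<^typ>\<open>ennreal\<close> exists, so a finite value only says that the finite
  partial sums are bounded; for nonnegative reals this is summability.\<close>

lemma summable_on_bonds:
  assumes "summable_interaction J"
  shows "(\<lambda>B. \<bar>J B\<bar>) summable_on bonds i"
proof (rule nonneg_bdd_above_summable_on)
  define C where "C = (\<Sum>\<^sub>\<infinity>B\<in>bonds i. ennreal \<bar>J B\<bar>)"
  have "C \<le> (SUP i. \<Sum>\<^sub>\<infinity>B\<in>bonds i. ennreal \<bar>J B\<bar>)"
    unfolding C_def by (rule SUP_upper) simp
  also have "\<dots> < \<infinity>"
    using assms by (simp add: summable_interaction_def)
  finally have C: "C < top" by simp
  have "(\<Sum>B\<in>F. \<bar>J B\<bar>) \<le> enn2real C" if "finite F" "F \<subseteq> bonds i" for F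
  proof -
    have "ennreal (\<Sum>B\<in>F. \<bar>J B\<bar>) = (\<Sum>\<^sub>\<infinity>B\<in>F. ennreal \<bar>J B\<bar>)"
      using that by (simp add: sum_ennreal)
    also have "\<dots> \<le> C"
      unfolding C_def using that
      by (intro infsum_mono_neutral) (auto intro: nonneg_summable_on_complete)
    finally have "enn2real (ennreal (\<Sum>B\<in>F. \<bar>J B\<bar>)) \<le> enn2real C"
      using C by (rule enn2real_mono)
    then show ?thesis
      by (simp add: sum_nonneg)
  qed
  then show "bdd_above (sum (\<lambda>B. \<bar>J B\<bar>) ` {F. F \<subseteq> bonds i \<and> finite F})"
    by (auto intro!: bdd_aboveI)
qed simp

lemma abs_sum_nonneg: "abs_sum J \<A> \<ge> 0"
  unfolding abs_sum_def by (rule infsum_nonneg) simp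

lemma abs_sum_mono:
  assumes "(\<lambda>B. \<bar>J B\<bar>) summable_on \<B>" "\<A> \<subseteq> \<B>"
  shows "abs_sum J \<A> \<le> abs_sum J \<B>"
  unfolding abs_sum_def using assms
  by (intro infsum_mono_neutral) (auto intro: summable_on_subset)

lemma abs_sum_Un_disjoint:
  assumes "(\<lambda>B. \<bar>J B\<bar>) summable_on (\<A> \<union> \<B>)" "\<A> \<inter> \<B> = {}"
  shows "abs_sum J (\<A> \<union> \<B>) = abs_sum J \<A> + abs_sum J \<B>"
  unfolding abs_sum_def using assms
  by (intro infsum_Un_disjoint) (auto intro: summable_on_subset)

lemma abs_chi: "\<sigma> \<in> configs \<Longrightarrow> \<bar>chi B \<sigma>\<bar> = 1"
proof -
  assume "\<sigma> \<in> configs"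
  then have "\<bar>\<sigma> j\<bar> = 1" for j
    by (auto simp: configs_def Pi_iff dest: spec[of _ j])
  then show ?thesis
    by (simp add: chi_def abs_prod)
qed

lemma signed_summable_on:
  assumes "(\<lambda>B. \<bar>J B\<bar>) summable_on \<A>" "\<sigma> \<in> configs"
  shows "(\<lambda>B. J B * chi B \<sigma>) summable_on \<A>"
  by (rule abs_summable_summable) (use assms in \<open>simp add: abs_mult abs_chi\<close>)

lemma abs_signed_sum_le:
  assumes "(\<lambda>B. \<bar>J B\<bar>) summable_on \<A>" "\<sigma> \<in> configs"
  shows "\<bar>signed_sum J \<A> \<sigma>\<bar> \<le> abs_sum J \<A>"
  using norm_infsum_bound[of "\<lambda>B. J B * chi B \<sigma>" \<A>] assms
  by (simp add: signed_sum_def abs_sum_def abs_mult abs_chi)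

lemma signed_sum_Un_disjoint:
  assumes "(\<lambda>B. \<bar>J B\<bar>) summable_on (\<A> \<union> \<B>)" "\<sigma> \<in> configs" "\<A> \<inter> \<B> = {}"
  shows "signed_sum J (\<A> \<union> \<B>) \<sigma> = signed_sum J \<A> \<sigma> + signed_sum J \<B> \<sigma>"
  unfolding signed_sum_def using signed_summable_on[OF assms(1,2)] assms(3)
  by (intro infsum_Un_disjoint) (auto intro: summable_on_subset)

section \<open>Bonds inside and outside growing balls\<close>

lemma box_at_mono: "k \<le> l \<Longrightarrow> box_at i k \<subseteq> box_at i l"
  by (auto simp: box_at_def)

lemma bonds_split:
  "bonds i = bonds_in i k \<union> bonds_out i k" "bonds_in i k \<inter> bonds_out i k = {}"
  by (auto simp: bonds_in_def bonds_out_def)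

lemma bonds_in_Suc_split:
  "bonds_in i (Suc k) = bonds_in i k \<union> shell i (Suc k)" "bonds_in i k \<inter> shell i (Suc k) = {}"
  using box_at_mono[of k "Suc k" i] by (auto simp: bonds_in_def shell_def)

lemma bonds_out_Suc_split:
  "bonds_out i k = bonds_out i (Suc k) \<union> shell i (Suc k)" "bonds_out i (Suc k) \<inter> shell i (Suc k) = {}"
  using box_at_mono[of k "Suc k" i] by (auto simp: bonds_out_def shell_def)

lemma bonds_subsets:
  "bonds_in i k \<subseteq> bonds i" "bonds_out i k \<subseteq> bonds i" "shell i k \<subseteq> bonds i"
  by (auto simp: bonds_in_def bonds_out_def shell_def)

lemma finite_subset_box_at:
  assumes "finite B"
  obtains k where "B \<subseteq> box_at i k"
proof
  show "B \<subseteq> box_at i (\<Sum>j\<in>B. nat (l1norm (j - i)))"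
  proof
    fix j assume "j \<in> B"
    then have "nat (l1norm (j - i)) \<le> (\<Sum>j\<in>B. nat (l1norm (j - i)))"
      using assms by (intro member_le_sum) auto
    then show "j \<in> box_at i (\<Sum>j\<in>B. nat (l1norm (j - i)))"
      by (simp add: box_at_def nat_le_iff)
  qed
qed

text \<open>Every finite set of bonds is eventually swallowed by the balls, and the absolute sum over all
  bonds is approximated by finite sets of bonds.\<close>

lemma abs_sum_bonds_out_tendsto_0:
  assumes J: "(\<lambda>B. \<bar>J B\<bar>) summable_on bonds i"
  shows "(\<lambda>k. abs_sum J (bonds_out i k)) \<longlonglongrightarrow> 0"
proof (rule LIMSEQ_I)
  fix e :: real assume "e > 0"
  obtain F where F: "finite F" "F \<subseteq> bonds i"
    and Fe: "dist (\<Sum>B\<in>F. \<bar>J B\<bar>) (abs_sum J (bonds i)) < e"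
    using infsum_finite_approximation[OF J, of "e / 2"] \<open>e > 0\<close>
    unfolding abs_sum_def by fastforce
  have "\<exists>k. B \<subseteq> box_at i k" if "B \<in> F" for B
  proof -
    have "finite B"
      using that F(2) by (auto simp: bonds_def)
    then show ?thesis
      by (rule finite_subset_box_at[of B i]) blast
  qed
  then obtain r where r: "\<And>B. B \<in> F \<Longrightarrow> B \<subseteq> box_at i (r B)"
    by metis
  have "norm (abs_sum J (bonds_out i k) - 0) < e" if k: "k \<ge> sum r F" for k
  proof -
    have "F \<subseteq> bonds_in i k"
    proof
      fix B assume "B \<in> F"
      then have "r B \<le> k"
        using member_le_sum[of B F r] F(1) k by auto
      then show "B \<in> bonds_in i k"
        using r[OF \<open>B \<in> F\<close>] box_at_mono[of "r B" k i] F(2) \<open>B \<in> F\<close>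
        by (auto simp: bonds_in_def)
    qed
    then have "abs_sum J F \<le> abs_sum J (bonds_in i k)"
      by (intro abs_sum_mono summable_on_subset[OF J] bonds_subsets)
    moreover have "abs_sum J F = (\<Sum>B\<in>F. \<bar>J B\<bar>)"
      using F(1) by (simp add: abs_sum_def)
    moreover have "abs_sum J (bonds i) = abs_sum J (bonds_in i k) + abs_sum J (bonds_out i k)"
      using abs_sum_Un_disjoint[OF _ bonds_split(2), of J i k] J
      by (simp flip: bonds_split(1))
    ultimately show ?thesis
      using Fe abs_sum_nonneg[of J "bonds_out i k"] by (simp add: dist_real_def)
  qed
  then show "\<exists>n0. \<forall>k\<ge>n0. norm (abs_sum J (bonds_out i k) - 0) < e"
    by blast
qed

lemma signed_sum_bonds_in_tendsto:
  assumes J: "(\<lambda>B. \<bar>J B\<bar>) summable_on bonds i" and \<sigma>: "\<sigma> \<in> configs"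
  shows "(\<lambda>k. signed_sum J (bonds_in i k) \<sigma>) \<longlonglongrightarrow> signed_sum J (bonds i) \<sigma>"
proof -
  have "signed_sum J (bonds i) \<sigma> = signed_sum J (bonds_in i k) \<sigma> + signed_sum J (bonds_out i k) \<sigma>" for k
    using signed_sum_Un_disjoint[OF _ \<sigma> bonds_split(2), of J i k] J
    by (simp flip: bonds_split(1))
  moreover have "\<bar>signed_sum J (bonds_out i k) \<sigma>\<bar> \<le> abs_sum J (bonds_out i k)" for k
    by (intro abs_signed_sum_le summable_on_subset[OF J] bonds_subsets \<sigma>)
  ultimately have "norm (signed_sum J (bonds_in i k) \<sigma> - signed_sum J (bonds i) \<sigma>)
      \<le> abs_sum J (bonds_out i k)" for k
    by (metis abs_minus_cancel add_diff_cancel_left' minus_diff_eq real_norm_def)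
  then have "(\<lambda>k. signed_sum J (bonds_in i k) \<sigma> - signed_sum J (bonds i) \<sigma>) \<longlonglongrightarrow> 0"
    by (intro Lim_null_comparison[OF _ abs_sum_bonds_out_tendsto_0[OF J]]) simp
  then show ?thesis
    by (simp add: LIM_zero_iff)
qed

lemma rate_range_tendsto_rate:
  assumes "(\<lambda>B. \<bar>J B\<bar>) summable_on bonds i" "\<sigma> \<in> configs"
  shows "(\<lambda>l. rate_range J \<beta> i l \<sigma>) \<longlonglongrightarrow> rate J \<beta> i \<sigma>"
proof -
  have "(\<lambda>l. rate_range J \<beta> i l \<sigma>)
      \<longlonglongrightarrow> exp (- \<beta> * 0) * exp (- \<beta> * signed_sum J (bonds i) \<sigma>)"
    unfolding rate_range_def range_factor_def
    by (intro tendsto_intros abs_sum_bonds_out_tendsto_0 signed_sum_bonds_in_tendsto assms)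
  then show ?thesis
    by (simp add: rate_def)
qed

section \<open>The law of the radius\<close>

lemma range_prob_one_factor:
  assumes "(\<lambda>B. \<bar>J B\<bar>) summable_on bonds i"
  shows "range_prob J \<beta> i 1 = range_factor J \<beta> i 1 * flip_denom J \<beta> i 1"
proof -
  have "abs_sum J (bonds i) = abs_sum J (bonds_in i 1) + abs_sum J (bonds_out i 1)"
    using abs_sum_Un_disjoint[OF _ bonds_split(2), of J i 1] assms
    by (simp flip: bonds_split(1))
  then show ?thesis
    by (simp add: range_prob_def range_factor_def flip_denom_def algebra_simps flip: exp_add)
qed

lemma range_prob_Suc_factor:
  assumes "(\<lambda>B. \<bar>J B\<bar>) summable_on bonds i" "k \<ge> 1"
  shows "range_prob J \<beta> i (Suc k) = range_factor J \<beta> i (Suc k) * flip_denom J \<beta> i (Suc k)"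
proof -
  have "abs_sum J (bonds_out i k) = abs_sum J (bonds_out i (Suc k)) + abs_sum J (shell i (Suc k))"
    using abs_sum_Un_disjoint[OF _ bonds_out_Suc_split(2), of J i k]
      summable_on_subset[OF assms(1) bonds_subsets(2), of k]
    by (simp flip: bonds_out_Suc_split(1))
  then show ?thesis
    using assms(2)
    by (simp add: range_prob_def range_factor_def flip_denom_def algebra_simps flip: exp_add)
qed

lemma range_prob_nonneg:
  assumes J: "(\<lambda>B. \<bar>J B\<bar>) summable_on bonds i" and "\<beta> > 0"
  shows "range_prob J \<beta> i k \<ge> 0"
proof -
  consider "k = 0" | "k = 1" | l where "k = Suc l" "l \<ge> 1"
    by (cases k) force+
  then show ?thesis
  proof cases
    case 2
    have "exp (- 2 * \<beta> * abs_sum J (bonds_in i 1)) * exp (- \<beta> * abs_sum J (bonds_out i 1)) \<le> 1"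
      using \<open>\<beta> > 0\<close> by (intro mult_le_one) (simp_all add: abs_sum_nonneg)
    then show ?thesis
      unfolding 2 range_prob_one_factor[OF J] by (simp add: range_factor_def flip_denom_def)
  next
    case 3
    then show ?thesis
      using \<open>\<beta> > 0\<close>
      by (simp add: range_prob_Suc_factor[OF J] range_factor_def flip_denom_def abs_sum_nonneg)
  qed (simp add: range_prob_def)
qed

lemma sum_range_prob:
  "(\<Sum>k\<le>Suc n. range_prob J \<beta> i k) = range_factor J \<beta> i (Suc n)"
  by (induction n) (simp_all add: range_prob_def range_factor_def)

lemma range_prob_sums_1:
  assumes "(\<lambda>B. \<bar>J B\<bar>) summable_on bonds i"
  shows "range_prob J \<beta> i sums 1"
proof -
  have "(\<lambda>n. range_factor J \<beta> i n) \<longlonglongrightarrow> exp (- \<beta> * 0)"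
    unfolding range_factor_def by (intro tendsto_intros abs_sum_bonds_out_tendsto_0 assms)
  then have "(\<lambda>n. \<Sum>k\<le>Suc n. range_prob J \<beta> i k) \<longlonglongrightarrow> 1"
    unfolding sum_range_prob by (simp add: LIMSEQ_Suc)
  then show ?thesis
    unfolding sums_def_le by (rule LIMSEQ_imp_Suc)
qed

section \<open>Decomposition of the rates\<close>

lemma M_const_pos: "M_const J \<beta> i > 0"
  by (simp add: M_const_def)

lemma M_const_range_prob_0: "M_const J \<beta> i * (1/2 * range_prob J \<beta> i 0) = exp (- \<beta> * abs_sum J (bonds i))"
  by (simp add: M_const_def range_prob_def flip: exp_add)

lemma rate_range_one_increment:
  assumes J: "(\<lambda>B. \<bar>J B\<bar>) summable_on bonds i" and "\<beta> > 0" and \<sigma>: "\<sigma> \<in> configs"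
  shows "M_const J \<beta> i * (range_prob J \<beta> i 1 * flip_prob J \<beta> i a 1 \<sigma>)
    = rate_range J \<beta> i 1 \<sigma> - exp (- \<beta> * abs_sum J (bonds i))"
proof -
  let ?In = "abs_sum J (bonds_in i 1)" and ?Out = "abs_sum J (bonds_out i 1)"
  let ?S = "signed_sum J (bonds_in i 1) \<sigma>"
  have "abs_sum J (bonds i) = ?In + ?Out"
    using abs_sum_Un_disjoint[OF _ bonds_split(2), of J i 1] J
    by (simp flip: bonds_split(1))
  then have rhs: "rate_range J \<beta> i 1 \<sigma> - exp (- \<beta> * abs_sum J (bonds i))
      = range_factor J \<beta> i 1 * (exp (- \<beta> * ?S) - exp (- \<beta> * ?In))"
    by (simp add: rate_range_def range_factor_def algebra_simps flip: exp_add)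
  show ?thesis
  proof (cases "flip_denom J \<beta> i 1 = 0")
    case True
    \<comment> \<open>The subtracted exponential equals \<open>1\<close>, so both nonnegative terms of its exponent vanish.\<close>
    then have "exp (- (2 * \<beta> * ?In + \<beta> * ?Out)) = 1"
      by (simp add: flip_denom_def algebra_simps flip: exp_add)
    then have "2 * (\<beta> * ?In) + \<beta> * ?Out = 0"
      by simp
    moreover have "\<beta> * ?In \<ge> 0" "\<beta> * ?Out \<ge> 0"
      using \<open>\<beta> > 0\<close> by (simp_all add: abs_sum_nonneg)
    ultimately have "\<beta> * ?In = 0"
      by linarith
    then have "?In = 0"
      using \<open>\<beta> > 0\<close> by simp
    moreover have "\<bar>?S\<bar> \<le> ?In"
      by (intro abs_signed_sum_le summable_on_subset[OF J] bonds_subsets \<sigma>)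
    ultimately show ?thesis
      unfolding rhs range_prob_one_factor[OF J] using True by simp
  next
    case False
    then show ?thesis
      unfolding rhs range_prob_one_factor[OF J] using M_const_pos[of J \<beta> i]
      by (simp add: flip_prob_def)
  qed
qed

text \<open>Passing from range \<open>k\<close> to \<open>k + 1\<close> moves the shell from the bonds bounded by their absolute
  values, through the range factor, to those entering with their signs. The rate therefore grows
  by the common factor times \<open>exp (- \<beta> * s) - exp (- \<beta> * Sh)\<close>, where \<open>s\<close> is the signed and \<open>Sh\<close> the
  absolute shell sum; this difference is the numerator of the flip probability.\<close>

lemma rate_range_Suc_increment:
  assumes J: "(\<lambda>B. \<bar>J B\<bar>) summable_on bonds i" and "\<beta> > 0" and \<sigma>: "\<sigma> \<in> configs" and "k \<ge> 1"
  shows "M_const J \<beta> i * (range_prob J \<beta> i (Suc k) * flip_prob J \<beta> i a (Suc k) \<sigma>)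
    = rate_range J \<beta> i (Suc k) \<sigma> - rate_range J \<beta> i k \<sigma>"
proof -
  let ?Sh = "abs_sum J (shell i (Suc k))" and ?s = "signed_sum J (shell i (Suc k)) \<sigma>"
  have "abs_sum J (bonds_out i k) = abs_sum J (bonds_out i (Suc k)) + ?Sh"
    using abs_sum_Un_disjoint[OF _ bonds_out_Suc_split(2), of J i k]
      summable_on_subset[OF J bonds_subsets(2), of k]
    by (simp flip: bonds_out_Suc_split(1))
  moreover have "signed_sum J (bonds_in i (Suc k)) \<sigma> = signed_sum J (bonds_in i k) \<sigma> + ?s"
    using signed_sum_Un_disjoint[OF _ \<sigma> bonds_in_Suc_split(2), of J i k]
      summable_on_subset[OF J bonds_subsets(1), of "Suc k"]
    by (simp flip: bonds_in_Suc_split(1))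
  ultimately have rhs: "rate_range J \<beta> i (Suc k) \<sigma> - rate_range J \<beta> i k \<sigma>
      = range_factor J \<beta> i (Suc k) * exp (- \<beta> * signed_sum J (bonds_in i k) \<sigma>)
        * (exp (- \<beta> * ?s) - exp (- \<beta> * ?Sh))"
    by (simp add: rate_range_def range_factor_def algebra_simps flip: exp_add)
  show ?thesis
  proof (cases "flip_denom J \<beta> i (Suc k) = 0")
    case True
    then have "?Sh = 0"
      using \<open>k \<ge> 1\<close> \<open>\<beta> > 0\<close> by (simp add: flip_denom_def)
    moreover have "\<bar>?s\<bar> \<le> ?Sh"
      by (intro abs_signed_sum_le summable_on_subset[OF J] bonds_subsets \<sigma>)
    ultimately show ?thesis
      unfolding rhs range_prob_Suc_factor[OF J \<open>k \<ge> 1\<close>] using True by simp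
  next
    case False
    then show ?thesis
      unfolding rhs range_prob_Suc_factor[OF J \<open>k \<ge> 1\<close>]
      using M_const_pos[of J \<beta> i] \<open>k \<ge> 1\<close>
      by (simp add: flip_prob_def)
  qed
qed

lemma rate_range_decomposition:
  assumes "(\<lambda>B. \<bar>J B\<bar>) summable_on bonds i" "\<beta> > 0" "\<sigma> \<in> configs" "l \<ge> 1"
  shows "rate_range J \<beta> i l \<sigma> = M_const J \<beta> i * (1/2 * range_prob J \<beta> i 0
    + (\<Sum>k=1..l. range_prob J \<beta> i k * flip_prob J \<beta> i a k \<sigma>))"
  using \<open>l \<ge> 1\<close>
proof (induction l rule: nat_induct_at_least)
  case base
  show ?case
    using rate_range_one_increment[OF assms(1-3), of a]
    unfolding distrib_left M_const_range_prob_0 by simp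
next
  case (Suc l)
  then show ?case
    using rate_range_Suc_increment[OF assms(1-3) Suc.hyps, of a]
    by (simp add: distrib_left)
qed

lemma rate_decomposition_sums:
  assumes "(\<lambda>B. \<bar>J B\<bar>) summable_on bonds i" "\<beta> > 0" "\<sigma> \<in> configs"
  shows "(\<lambda>k. range_prob J \<beta> i (Suc k) * flip_prob J \<beta> i a (Suc k) \<sigma>)
    sums (rate J \<beta> i \<sigma> / M_const J \<beta> i - 1/2 * range_prob J \<beta> i 0)"
proof -
  let ?f = "\<lambda>k. range_prob J \<beta> i k * flip_prob J \<beta> i a k \<sigma>"
  have "rate_range J \<beta> i (Suc n) \<sigma> / M_const J \<beta> i - 1/2 * range_prob J \<beta> i 0
      = (\<Sum>k<Suc n. ?f (Suc k))" for n
  proof -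
    have "(\<Sum>k=1..Suc n. ?f k) = (\<Sum>k<Suc n. ?f (Suc k))"
      by (rule sum.atLeast1_atMost_eq[of ?f "Suc n", unfolded One_nat_def[symmetric]])
    then show ?thesis
      using rate_range_decomposition[OF assms, of "Suc n" a] M_const_pos[of J \<beta> i]
      by (simp add: field_simps)
  qed
  moreover have "(\<lambda>n. rate_range J \<beta> i (Suc n) \<sigma> / M_const J \<beta> i - 1/2 * range_prob J \<beta> i 0)
      \<longlonglongrightarrow> rate J \<beta> i \<sigma> / M_const J \<beta> i - 1/2 * range_prob J \<beta> i 0"
    using M_const_pos[of J \<beta> i]
    by (intro tendsto_intros LIMSEQ_Suc rate_range_tendsto_rate assms) simp
  ultimately have "(\<lambda>n. \<Sum>k<Suc n. ?f (Suc k))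
      \<longlonglongrightarrow> rate J \<beta> i \<sigma> / M_const J \<beta> i - 1/2 * range_prob J \<beta> i 0"
    by (simp only:)
  then show ?thesis
    unfolding sums_def by (rule LIMSEQ_imp_Suc)
qed

theorem theorem2:
  fixes J :: "(int ^ 'd::finite) set \<Rightarrow> real"
    and \<beta> :: real
    and i :: "int ^ 'd"
    and a :: "nat \<Rightarrow> (int ^ 'd \<Rightarrow> real) \<Rightarrow> real"
  assumes "summable_interaction J"
    and "\<beta> > 0"
    and "\<And>k \<sigma>. k \<ge> 1 \<Longrightarrow> \<sigma> \<in> configs \<Longrightarrow> a k \<sigma> \<in> {0..1}"
  shows "((\<forall>k. range_prob J \<beta> i k \<ge> 0) \<and> range_prob J \<beta> i sums 1) \<and>
    (\<forall>l\<ge>1. \<forall>\<sigma>\<in>configs.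
       rate_range J \<beta> i l \<sigma> =
         M_const J \<beta> i * (1/2 * range_prob J \<beta> i 0
           + (\<Sum>k=1..l. range_prob J \<beta> i k * flip_prob J \<beta> i a k \<sigma>))) \<and>
    (\<forall>\<sigma>\<in>configs.
       summable (\<lambda>k. range_prob J \<beta> i (Suc k) * flip_prob J \<beta> i a (Suc k) \<sigma>) \<and>
       rate J \<beta> i \<sigma> =
         M_const J \<beta> i * (1/2 * range_prob J \<beta> i 0
           + (\<Sum>k. range_prob J \<beta> i (Suc k) * flip_prob J \<beta> i a (Suc k) \<sigma>)))"
proof (intro conjI allI ballI impI)
  have J: "(\<lambda>B. \<bar>J B\<bar>) summable_on bonds i"
    by (rule summable_on_bonds) (rule assms(1))
  show "range_prob J \<beta> i k \<ge> 0" for k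
    by (rule range_prob_nonneg[OF J assms(2)])
  show "range_prob J \<beta> i sums 1"
    by (rule range_prob_sums_1[OF J])
  show "rate_range J \<beta> i l \<sigma> = M_const J \<beta> i * (1/2 * range_prob J \<beta> i 0
      + (\<Sum>k=1..l. range_prob J \<beta> i k * flip_prob J \<beta> i a k \<sigma>))"
    if "l \<ge> 1" "\<sigma> \<in> configs" for l \<sigma>
    by (rule rate_range_decomposition[OF J assms(2) that(2,1)])
  fix \<sigma> :: "int ^ 'd \<Rightarrow> real" assume \<sigma>: "\<sigma> \<in> configs"
  note decomposition = rate_decomposition_sums[OF J assms(2) \<sigma>, of a]
  then show "summable (\<lambda>k. range_prob J \<beta> i (Suc k) * flip_prob J \<beta> i a (Suc k) \<sigma>)"
    by (rule sums_summable)
  show "rate J \<beta> i \<sigma> = M_const J \<beta> i * (1/2 * range_prob J \<beta> i 0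
      + (\<Sum>k. range_prob J \<beta> i (Suc k) * flip_prob J \<beta> i a (Suc k) \<sigma>))"
    using M_const_pos[of J \<beta> i] by (simp flip: sums_unique[OF decomposition])
qed

end
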